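(* (a) If $f\in L^2(\mathbb{T})$ is continuous, $f$ has infinitely many zeros in $\mathbb{T}$, and $\hat f:\mathbb{Z}\to\mathbb{C}$ is finitely supported, then $f\equiv 0$. (b) Let $d\ge1$. If $f\in L^2(\mathbb{R}^d)$ is continuous, $f$ vanishes on some nonempty open set, and $\hat f$ is compactly supported, then $f\equiv0$.
   Context: $\mathbb{T}=\mathbb{R}/2\pi\mathbb{Z}$; functions are complex-valued, and functions on $\mathbb{T}$ are $2\pi$-periodic. In (a), $\hat f(n)=\frac{1}{2\pi}\int_{\mathbb{T}}f(t)e^{-int}\,dt$, $n\in\mathbb{Z}$, are the Fourier coefficients. In (b), $\hat f$ is the Fourier transform, given by $\hat f(\xi)=\int_{\mathbb{R}^d}f(x)e^{-i\xi x}\,dx$ for $f\in L^1\cap L^2(\mathbb{R}^d)$ and extended by continuity to $L^2(\mathbb{R}^d)$. *)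

theory Defs
  imports "HOL-Analysis.Analysis"
begin

definition square_integrable :: "'a measure \<Rightarrow> ('a \<Rightarrow> complex) \<Rightarrow> bool" where
  "square_integrable M f \<longleftrightarrow>
     f \<in> borel_measurable M \<and> integrable M (\<lambda>x. (norm (f x))\<^sup>2)"

text \<open>Functions on the torus are 2 pi-periodic functions on the reals; \<open>[0, 2 pi)\<close> is
  the fundamental domain. The total mass of \<open>circle_measure\<close> is 2 pi.\<close>

definition circle_measure :: "real measure" where
  "circle_measure = restrict_space lborel {0..<2 * pi}"

definition periodic_2pi :: "(real \<Rightarrow> complex) \<Rightarrow> bool" where
  "periodic_2pi f \<longleftrightarrow> (\<forall>t. f (t + 2 * pi) = f t)"

definition fourier_coeff :: "(real \<Rightarrow> complex) \<Rightarrow> int \<Rightarrow> complex" where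
  "fourier_coeff f n =
     1 / (2 * pi) * (LINT t|circle_measure. f t * exp (- (\<i> * of_int n * of_real t)))"

definition fourier_integral :: "(real^'d \<Rightarrow> complex) \<Rightarrow> real^'d \<Rightarrow> complex" where
  "fourier_integral f \<xi> = (LINT x|lborel. f x * exp (- (\<i> * of_real (\<xi> \<bullet> x))))"

text \<open>The square of the L2 distance, as an extended nonnegative real.\<close>

definition L2_dist_sq :: "(real^'d \<Rightarrow> complex) \<Rightarrow> (real^'d \<Rightarrow> complex) \<Rightarrow> ennreal" where
  "L2_dist_sq f g = (\<integral>\<^sup>+x. ennreal ((norm (f x - g x))\<^sup>2) \<partial>lborel)"

text \<open>Extension by continuity: \<open>g\<close> is (a Borel representative of) the Fourier transform of
  the L2 function \<open>f\<close> if it is the L2 limit of the Fourier integrals of some sequence in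
  the intersection of L1 and L2 that converges to \<open>f\<close> in L2. By Plancherel's theorem such a
  \<open>g\<close> exists for every \<open>f\<close> in L2, is unique up to null sets, and does not depend on the
  sequence. It is a relation since \<open>g\<close> is determined only almost everywhere.\<close>

definition has_fourier_transform_L2 ::
    "(real^'d \<Rightarrow> complex) \<Rightarrow> (real^'d \<Rightarrow> complex) \<Rightarrow> bool" where
  "has_fourier_transform_L2 f g \<longleftrightarrow>
     square_integrable lborel f \<and> square_integrable lborel g \<and>
     (\<exists>h :: nat \<Rightarrow> real^'d \<Rightarrow> complex.
        (\<forall>n. integrable lborel (h n) \<and> square_integrable lborel (h n)) \<and>
        (\<lambda>n. L2_dist_sq (h n) f) \<longlonglongrightarrow> 0 \<and>
        (\<lambda>n. L2_dist_sq (fourier_integral (h n)) g) \<longlonglongrightarrow> 0)"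

text \<open>Compact support is understood for classes of functions modulo null sets.\<close>

definition ae_compactly_supported :: "(real^'d \<Rightarrow> complex) \<Rightarrow> bool" where
  "ae_compactly_supported g \<longleftrightarrow>
     (\<exists>K. compact K \<and> (AE \<xi> in lborel. \<xi> \<notin> K \<longrightarrow> g \<xi> = 0))"

end

theory Submission
  imports Defs "HOL-Complex_Analysis.Cauchy_Integral_Formula"
    "HOL-Probability.Characteristic_Functions" "HOL-Real_Asymp.Real_Asymp"
begin

text \<open>Both parts hold because a function with bounded spectrum is the restriction of an analytic
  function, and an analytic function whose zeros accumulate vanishes. The work lies in
  showing that \<open>f\<close> is pointwise given by its Fourier expansion.

  On the circle, a continuous function all of whose Fourier coefficients vanish is zero, by
  the Stone-Weierstrass theorem (\<open>fourier_null_imp_zero\<close>). Applied to the difference of \<open>f\<close> and its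
  Fourier sum, this shows that \<open>f\<close> is a trigonometric polynomial
  (\<open>finite_fourier_support_imp_trig_poly\<close>). Up to a factor \<open>e\<^sup>i\<^sup>N\<^sup>t\<close> it is an ordinary polynomial in \<open>e\<^sup>i\<^sup>t\<close>,
  and infinitely many zeros force that polynomial to be zero (\<open>trig_poly_infinite_zeros\<close>).

  On Euclidean space, let \<open>g\<close> be the Fourier transform of \<open>f\<close>. Being square integrable with compact
  support, \<open>g\<close> is integrable, and the claim is that the inverse Fourier integral of \<open>g\<close> is \<open>f\<close>
  (\<open>fourier_inversion_integrable\<close>). Plancherel's theorem can be bypassed here: the multiplication
  formula, which is an instance of Fubini's theorem, survives the L2 limit when it is tested
  against modulated Gaussians, whose Fourier transforms are explicit
  (\<open>fourier_transform_gauss_pairing\<close>). Letting the Gaussians flatten yields the inverse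
  Fourier integral on one side and, because the transformed Gaussians form an approximate identity, the
  value of the continuous function \<open>f\<close> on the other. Finally, the inverse Fourier integral of a
  function with bounded support is an entire power series along every line, so it
  vanishes identically as soon as it vanishes on an open set
  (\<open>fourier_band_limited_zero_on_open\<close>).\<close>

section \<open>Fourier coefficients of continuous functions\<close>

lemma circle_integral_eq:
  fixes h :: "real \<Rightarrow> complex"
  assumes "continuous_on UNIV h"
  shows "(LINT t|circle_measure. h t) = integral {0..2 * pi} h"
proof -
  have c: "continuous_on {0..2 * pi} h" using assms continuous_on_subset by blast
  have si: "set_integrable lborel {0..2 * pi} h"
    by (rule borel_integrable_atLeastAtMost'[OF c])
  have [measurable]: "h \<in> borel_measurable borel"
    using assms by (rule borel_measurable_continuous_onI)
  have "(LINT t|circle_measure. h t) = (LINT t:{0..<2 * pi}|lborel. h t)"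
    unfolding circle_measure_def set_lebesgue_integral_def
    by (rule integral_restrict_space) simp
  also have "\<dots> = (LINT t:{0..2 * pi}|lborel. h t)"
    unfolding set_lebesgue_integral_def
    by (rule integral_cong_AE) (use AE_lborel_singleton[of "2*pi"] in \<open>auto elim!: eventually_mono simp: indicator_def\<close>)
  also have "\<dots> = integral {0..2 * pi} h"
    by (rule set_borel_integral_eq_integral(2)[OF si])
  finally show ?thesis .
qed

lemma fourier_coeff_continuous:
  assumes "continuous_on UNIV f"
  shows "fourier_coeff f n = 1 / (2 * pi) * integral {0..2 * pi} (\<lambda>t. f t * cis (- (of_int n * t)))"
  unfolding fourier_coeff_def
  by (subst circle_integral_eq) (auto intro!: continuous_intros assms simp: cis_conv_exp mult_ac)

lemma integrable_circle:
  assumes "continuous_on UNIV (f :: real \<Rightarrow> complex)"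
  shows "f integrable_on {0..2 * pi}"
  by (intro integrable_continuous_interval continuous_on_subset[OF assms]) auto

text \<open>The point of this class is that it is closed under multiplication by \<open>e\<^sup>i\<^sup>k\<^sup>t\<close>, which only
  shifts the coefficients, and hence by every polynomial in \<open>cos t\<close> and \<open>sin t\<close>.\<close>

definition fourier_null :: "(real \<Rightarrow> complex) \<Rightarrow> bool" where
  "fourier_null g \<longleftrightarrow> continuous_on UNIV g \<and> (\<forall>n. fourier_coeff g n = 0)"

lemma fourier_null_iff:
  "fourier_null g \<longleftrightarrow> continuous_on UNIV g \<and> (\<forall>n::int. integral {0..2 * pi} (\<lambda>t. g t * cis (of_int n * t)) = 0)"
proof (cases "continuous_on UNIV g")
  case True
  have "(\<forall>n. fourier_coeff g n = 0) \<longleftrightarrow> (\<forall>n::int. integral {0..2 * pi} (\<lambda>t. g t * cis (of_int (-n) * t)) = 0)"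
    by (simp add: fourier_coeff_continuous[OF True])
  also have "\<dots> \<longleftrightarrow> (\<forall>n::int. integral {0..2 * pi} (\<lambda>t. g t * cis (of_int n * t)) = 0)"
    by (metis minus_minus)
  finally show ?thesis using True by (simp add: fourier_null_def)
qed (simp add: fourier_null_def)

lemma fourier_null_add:
  assumes "fourier_null f" "fourier_null g"
  shows "fourier_null (\<lambda>t. f t + g t)"
  unfolding fourier_null_iff
proof (intro conjI allI)
  have c: "continuous_on UNIV f" "continuous_on UNIV g" using assms by (auto simp: fourier_null_def)
  show "continuous_on UNIV (\<lambda>t. f t + g t)" by (intro continuous_intros c)
  fix n :: int
  show "integral {0..2 * pi} (\<lambda>t. (f t + g t) * cis (of_int n * t)) = 0"
    using assms unfolding fourier_null_iff distrib_right
    by (subst integral_add) (auto intro!: integrable_circle continuous_intros c)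
qed

lemma fourier_null_const_mult:
  assumes "fourier_null f"
  shows "fourier_null (\<lambda>t. f t * c)"
  unfolding fourier_null_iff
proof (intro conjI allI)
  have cf: "continuous_on UNIV f" using assms by (auto simp: fourier_null_def)
  show "continuous_on UNIV (\<lambda>t. f t * c)" by (intro continuous_intros cf)
  fix n :: int
  show "integral {0..2 * pi} (\<lambda>t. f t * c * cis (of_int n * t)) = 0"
    using assms unfolding fourier_null_iff by (simp add: mult.assoc mult.commute[of c])
      (simp flip: mult.assoc)
qed

lemma fourier_null_cis_mult:
  assumes "fourier_null f"
  shows "fourier_null (\<lambda>t. f t * cis (of_int k * t))"
  unfolding fourier_null_iff
proof (intro conjI allI)
  have cf: "continuous_on UNIV f" using assms by (auto simp: fourier_null_def)
  show "continuous_on UNIV (\<lambda>t. f t * cis (of_int k * t))" by (intro continuous_intros cf)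
  fix n :: int
  have "(\<lambda>t. f t * cis (of_int k * t) * cis (of_int n * t)) = (\<lambda>t. f t * cis (of_int (k + n) * t))"
    by (auto simp: mult.assoc cis_mult distrib_right)
  thus "integral {0..2 * pi} (\<lambda>t. f t * cis (of_int k * t) * cis (of_int n * t)) = 0"
    using assms unfolding fourier_null_iff by metis
qed

text \<open>Since the claim is made for every \<open>g\<close>, the case of a product of polynomials follows by using
  the induction hypotheses one after the other. For the linear case, a real linear functional
  of \<open>e\<^sup>i\<^sup>t\<close> is a combination of \<open>e\<^sup>i\<^sup>t\<close> and \<open>e\<^sup>-\<^sup>i\<^sup>t\<close>.\<close>

lemma fourier_null_real_polynomial_mult:
  fixes q :: "complex \<Rightarrow> real"
  assumes "real_polynomial_function q" "fourier_null g"
  shows "fourier_null (\<lambda>t. g t * of_real (q (cis t)))"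
  using assms
proof (induction arbitrary: g)
  case (linear l)
  interpret bounded_linear l by fact
  have eq: "complex_of_real (l (cis t)) =
      cis (of_int 1 * t) * ((l 1 - \<i> * l \<i>) / 2) + cis (of_int (-1) * t) * ((l 1 + \<i> * l \<i>) / 2)" for t
  proof -
    have "cis t = cos t *\<^sub>R 1 + sin t *\<^sub>R \<i>" by (simp add: complex_eq_iff)
    hence "l (cis t) = cos t * l 1 + sin t * l \<i>" by (simp add: add scaleR)
    thus ?thesis by (simp add: complex_eq_iff field_simps)
  qed
  show ?case unfolding eq distrib_left mult.assoc[symmetric]
    by (intro fourier_null_add fourier_null_const_mult fourier_null_cis_mult \<open>fourier_null g\<close>)
next
  case (const c)
  then show ?case by (rule fourier_null_const_mult)
next
  case (add f h)
  show ?case unfolding of_real_add distrib_left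
    by (intro fourier_null_add add)
next
  case (mult f h)
  show ?case unfolding of_real_mult mult.assoc[symmetric]
    by (intro mult)
qed

lemma periodic_Arg2pi_cis:
  assumes "g (2 * pi) = g 0" "t \<in> {0..2 * pi}"
  shows "g (Arg2pi (cis t)) = g t"
proof (cases "t = 2 * pi")
  case True
  have "Arg2pi 1 = 0" by (intro Arg2pi_unique[of 1]) auto
  thus ?thesis using True assms by simp
next
  case False
  hence "Arg2pi (cis t) = t" using assms
    by (intro Arg2pi_unique[of 1]) (auto simp: cis_conv_exp)
  thus ?thesis by simp
qed

text \<open>\<open>Arg2pi\<close> jumps at 1, so continuity there has to come from \<open>g (2 * pi) = g 0\<close>. Working
  with preimages of closed sets avoids a case distinction: on the circle such a preimage is the image
  under \<open>cis\<close> of a compact subset of \<open>[0, 2 pi]\<close>.\<close>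

lemma continuous_on_sphere_Arg2pi:
  fixes g :: "real \<Rightarrow> 'a::topological_space"
  assumes "continuous_on {0..2 * pi} g" "g (2 * pi) = g 0"
  shows "continuous_on (sphere 0 1) (\<lambda>z. g (Arg2pi z))"
proof -
  have "closed ((\<lambda>z. g (Arg2pi z)) -` B \<inter> sphere 0 1)" if B: "closed B" for B
  proof -
    have "(\<lambda>z. g (Arg2pi z)) -` B \<inter> sphere 0 1 = cis ` (g -` B \<inter> {0..2 * pi})"
    proof (intro equalityI subsetI)
      fix z assume z: "z \<in> (\<lambda>z. g (Arg2pi z)) -` B \<inter> sphere 0 1"
      hence "z = cis (Arg2pi z)" using Arg2pi_eq[of z] by (simp add: cis_conv_exp is_Arg_def)
      moreover have "Arg2pi z \<in> g -` B \<inter> {0..2 * pi}"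
        using z Arg2pi_ge_0[of z] Arg2pi_lt_2pi[of z] by auto
      ultimately show "z \<in> cis ` (g -` B \<inter> {0..2 * pi})" by blast
    next
      fix z assume "z \<in> cis ` (g -` B \<inter> {0..2 * pi})"
      then obtain t where t: "z = cis t" "g t \<in> B" "0 \<le> t" "t \<le> 2 * pi" by auto
      have "g (Arg2pi z) = g t"
        using periodic_Arg2pi_cis[of g t] t assms by simp
      thus "z \<in> (\<lambda>z. g (Arg2pi z)) -` B \<inter> sphere 0 1" using t by simp
    qed
    moreover have "compact (g -` B \<inter> {0..2 * pi})"
      using continuous_on_closed_vimage[of "{0..2 * pi}" g] assms(1) B
      by (auto simp: compact_eq_bounded_closed intro: bounded_subset[OF bounded_closed_interval])
    ultimately show ?thesis
      by (simp add: compact_imp_closed compact_continuous_image continuous_on_cis)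
  qed
  thus ?thesis by (subst continuous_on_closed_vimage) auto
qed

text \<open>Uniqueness of Fourier coefficients. By the Stone-Weierstrass theorem the conjugate of \<open>g\<close>
  is a uniform limit of polynomials in \<open>e\<^sup>i\<^sup>t\<close> and its conjugate; the product of \<open>g\<close> with any of
  these has integral zero, so the integral of \<open>\<bar>g\<bar>\<^sup>2\<close> is zero.\<close>

lemma fourier_null_imp_zero:
  assumes null: "fourier_null g" and per: "g (2 * pi) = g 0" and t: "t \<in> {0..2 * pi}"
  shows "g t = 0"
proof -
  have cont: "continuous_on UNIV g" using null by (simp add: fourier_null_def)
  define I where "I = integral {0..2 * pi} (\<lambda>t. (norm (g t))\<^sup>2)"
  define J where "J = integral {0..2 * pi} (\<lambda>t. norm (g t))"
  have iJ: "(\<lambda>t. norm (g t)) integrable_on {0..2 * pi}"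
    by (intro integrable_continuous_interval continuous_intros continuous_on_subset[OF cont]) auto
  have J: "J \<ge> 0" unfolding J_def by (intro integral_nonneg iJ) auto
  have le: "\<bar>I\<bar> \<le> e * J" if e: "e > 0" for e
  proof -
    have "continuous_on (sphere 0 1) (\<lambda>z. cnj (g (Arg2pi z)))"
      by (intro continuous_intros continuous_on_sphere_Arg2pi continuous_on_subset[OF cont] per) auto
    then obtain p :: "complex \<Rightarrow> complex" where p: "polynomial_function p"
        "\<And>z. z \<in> sphere 0 1 \<Longrightarrow> norm (cnj (g (Arg2pi z)) - p z) < e"
      using Stone_Weierstrass_polynomial_function[OF compact_sphere _ e] by metis
    have approx: "norm (cnj (g t) - p (cis t)) \<le> e" if t: "t \<in> {0..2 * pi}" for t
      using p(2)[of "cis t"] periodic_Arg2pi_cis[of g t] per t by (simp add: less_imp_le)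
    have "real_polynomial_function (\<lambda>z. Re (p z))" "real_polynomial_function (\<lambda>z. Im (p z))"
      using p(1) bounded_linear_Re bounded_linear_Im unfolding polynomial_function_def o_def by blast+
    hence "fourier_null (\<lambda>t. g t * of_real (Re (p (cis t))) + g t * of_real (Im (p (cis t))) * \<i>)"
      by (intro fourier_null_add fourier_null_const_mult fourier_null_real_polynomial_mult null)
    moreover have "g t * of_real (Re (p (cis t))) + g t * of_real (Im (p (cis t))) * \<i> = g t * p (cis t)" for t
      by (simp add: complex_eq_iff algebra_simps)
    ultimately have np: "fourier_null (\<lambda>t. g t * p (cis t))" by simp
    hence z: "integral {0..2 * pi} (\<lambda>t. g t * p (cis t)) = 0"
      unfolding fourier_null_iff by (auto dest: spec[of _ 0])
    have ip: "(\<lambda>t. g t * p (cis t)) integrable_on {0..2 * pi}"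
      using np by (intro integrable_circle) (simp add: fourier_null_def)
    have ig: "(\<lambda>t. g t * cnj (g t)) integrable_on {0..2 * pi}"
      by (intro integrable_circle continuous_intros cont)
    have "of_real I = integral {0..2 * pi} (\<lambda>t. of_real ((norm (g t))\<^sup>2) :: complex)"
    proof -
      have "(\<lambda>t. (norm (g t))\<^sup>2) integrable_on {0..2 * pi}"
        by (intro integrable_continuous_interval continuous_intros continuous_on_subset[OF cont]) auto
      from integral_linear[OF this bounded_linear_of_real[where 'a = complex]]
      show ?thesis by (simp add: I_def o_def del: of_real_power)
    qed
    also have "\<dots> = integral {0..2 * pi} (\<lambda>t. g t * cnj (g t))"
      by (simp only: complex_norm_square)
    also have "\<dots> = integral {0..2 * pi} (\<lambda>t. g t * cnj (g t)) - integral {0..2 * pi} (\<lambda>t. g t * p (cis t))"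
      using z by simp
    also have "\<dots> = integral {0..2 * pi} (\<lambda>t. g t * (cnj (g t) - p (cis t)))"
      by (simp add: integral_diff[OF ig ip] right_diff_distrib)
    finally have "\<bar>I\<bar> = norm (integral {0..2 * pi} (\<lambda>t. g t * (cnj (g t) - p (cis t))))"
      by (metis norm_of_real)
    also have "\<dots> \<le> integral {0..2 * pi} (\<lambda>t. e * norm (g t))"
    proof (rule integral_norm_bound_integral)
      show "(\<lambda>t. g t * (cnj (g t) - p (cis t))) integrable_on {0..2 * pi}"
        unfolding right_diff_distrib by (intro integrable_diff ig ip)
      show "(\<lambda>t. e * norm (g t)) integrable_on {0..2 * pi}"
        using integrable_cmul[OF iJ, of e] by simp
      show "norm (g t * (cnj (g t) - p (cis t))) \<le> e * norm (g t)" if "t \<in> {0..2 * pi}" for t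
        using mult_left_mono[OF approx[OF that], of "norm (g t)"] by (simp add: norm_mult mult.commute)
    qed
    also have "\<dots> = e * J" by (simp add: J_def)
    finally show ?thesis .
  qed
  have "I = 0"
  proof (rule ccontr)
    assume "I \<noteq> 0"
    \<comment> \<open>\<open>J + 1\<close> because \<open>J\<close> could still be zero\<close>
    hence "0 < \<bar>I\<bar> / (2 * (J + 1))" using J by simp
    from le[OF this] have "\<bar>I\<bar> * (2 * (J + 1)) \<le> \<bar>I\<bar> * J" using J by (simp add: field_simps)
    thus False using \<open>I \<noteq> 0\<close> J by simp
  qed
  have c2: "continuous_on (cbox 0 (2 * pi)) (\<lambda>t. (norm (g t))\<^sup>2)"
    by (intro continuous_intros continuous_on_subset[OF cont]) auto
  have "((\<lambda>t. (norm (g t))\<^sup>2) has_integral 0) (cbox 0 (2 * pi))"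
    using integrable_integral[OF integrable_continuous[OF c2]] \<open>I = 0\<close> by (simp add: I_def)
  hence "(norm (g t))\<^sup>2 = 0"
    by (rule has_integral_0_cbox_imp_0[OF c2, rotated])
      (use t pi_gt_zero in \<open>simp_all del: pi_gt_zero add: box_real\<close>)
  thus ?thesis by simp
qed

section \<open>Trigonometric polynomials\<close>

lemma integral_cis_int:
  "integral {0..2 * pi} (\<lambda>t. cis (of_int k * t)) = (if k = 0 then 2 * pi else 0)"
proof (cases "k = 0")
  case False
  have "((\<lambda>t. cis (of_int k * t)) has_integral
      (cis (of_int k * (2 * pi)) / (\<i> * of_int k) - cis (of_int k * 0) / (\<i> * of_int k))) {0..2 * pi}"
  proof (rule fundamental_theorem_of_calculus)
    fix t :: real
    have "((\<lambda>z. exp (\<i> * of_int k * z) / (\<i> * of_int k)) has_field_derivative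
        exp (\<i> * of_int k * of_real t)) (at (of_real t))"
      using False by (auto intro!: derivative_eq_intros)
    from has_vector_derivative_real_field[OF this]
    show "((\<lambda>t. cis (of_int k * t) / (\<i> * of_int k)) has_vector_derivative cis (of_int k * t)) (at t within {0..2 * pi})"
      by (simp add: cis_conv_exp mult.assoc)
  qed simp
  moreover have "cis (of_int k * (2 * pi)) = 1"
    using cis_multiple_2pi[of "of_int k"] by (simp add: mult.commute)
  ultimately show ?thesis using False by (simp add: integral_unique)
qed (simp add: scaleR_conv_of_real)

text \<open>The difference of the two sides has vanishing Fourier coefficients, by orthogonality of the
  exponentials.\<close>

lemma finite_fourier_support_imp_trig_poly:
  assumes per: "periodic_2pi f" and cont: "continuous_on UNIV f"
    and fin: "finite {n. fourier_coeff f n \<noteq> 0}"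
  shows "f t = (\<Sum>n | fourier_coeff f n \<noteq> 0. fourier_coeff f n * cis (of_int n * t))"
proof -
  define S where "S = {n. fourier_coeff f n \<noteq> 0}"
  define P where "P = (\<lambda>t. \<Sum>n\<in>S. fourier_coeff f n * cis (of_int n * t))"
  have cP: "continuous_on UNIV P" unfolding P_def by (intro continuous_intros)
  have shiftP: "P (t + 2 * pi) = P t" for t
    unfolding P_def
  proof (intro sum.cong refl)
    fix n
    have "cis (of_int n * (2 * pi)) = 1"
      using cis_multiple_2pi[of "of_int n"] by (simp add: mult.commute)
    thus "fourier_coeff f n * cis (of_int n * (t + 2 * pi)) = fourier_coeff f n * cis (of_int n * t)"
      by (simp add: distrib_left flip: cis_mult)
  qed
  have coeffP: "integral {0..2 * pi} (\<lambda>t. P t * cis (- (of_int m * t))) = 2 * pi * fourier_coeff f m" for m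
  proof -
    have "P t * cis (- (of_int m * t)) = (\<Sum>n\<in>S. fourier_coeff f n * cis (of_int (n - m) * t))" for t
      unfolding P_def sum_distrib_right
      by (intro sum.cong refl) (simp add: mult.assoc cis_mult left_diff_distrib)
    hence "integral {0..2 * pi} (\<lambda>t. P t * cis (- (of_int m * t)))
        = integral {0..2 * pi} (\<lambda>t. \<Sum>n\<in>S. fourier_coeff f n * cis (of_int (n - m) * t))" by simp
    also have "\<dots> = (\<Sum>n\<in>S. fourier_coeff f n * integral {0..2 * pi} (\<lambda>t. cis (of_int (n - m) * t)))"
      using fin by (subst integral_sum) (auto simp: S_def intro!: integrable_circle continuous_intros)
    also have "\<dots> = (\<Sum>n\<in>S. if n = m then fourier_coeff f m * (2 * pi) else 0)"
      by (intro sum.cong refl) (simp add: integral_cis_int del: of_int_diff)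
    also have "\<dots> = 2 * pi * fourier_coeff f m"
      using fin by (simp add: S_def)
    finally show ?thesis .
  qed
  define g where "g = (\<lambda>t. f t - P t)"
  have "fourier_coeff g m = 0" for m
  proof -
    have "integral {0..2 * pi} (\<lambda>t. g t * cis (- (of_int m * t)))
       = integral {0..2 * pi} (\<lambda>t. f t * cis (- (of_int m * t))) - integral {0..2 * pi} (\<lambda>t. P t * cis (- (of_int m * t)))"
      unfolding g_def left_diff_distrib
      by (intro integral_diff integrable_circle continuous_intros cont cP)
    also have "\<dots> = 0" unfolding coeffP by (simp add: fourier_coeff_continuous[OF cont])
    finally show ?thesis unfolding g_def
      by (subst fourier_coeff_continuous) (auto intro!: continuous_intros cont cP)
  qed
  hence null: "fourier_null g"
    unfolding fourier_null_def g_def by (auto intro!: continuous_intros cont cP)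
  have shift: "g (t + 2 * pi) = g t" for t
    using per by (simp add: g_def periodic_2pi_def shiftP)
  interpret periodic_fun_simple g "2 * pi"
    by standard (rule shift)
  have "g (2 * pi) = g 0" using shift[of 0] by simp
  note zero = fourier_null_imp_zero[OF null this]
  define k where "k = \<lfloor>t / (2 * pi)\<rfloor>"
  have "of_int k \<le> t / (2 * pi)" "t / (2 * pi) \<le> of_int k + 1"
    unfolding k_def by linarith+
  hence "t - of_int k * (2 * pi) \<in> {0..2 * pi}" by (simp add: field_simps)
  from zero[OF this] have "g t = 0" by (simp only: minus_of_int)
  thus ?thesis by (simp add: g_def P_def S_def)
qed

text \<open>Multiplication by a power of \<open>e\<^sup>i\<^sup>t\<close> removes the negative frequencies and leaves a polynomial
  in \<open>e\<^sup>i\<^sup>t\<close>, which has only finitely many roots unless it is zero.\<close>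

lemma trig_poly_infinite_zeros:
  assumes "finite S" and inf: "infinite {t \<in> {0..<2 * pi}. (\<Sum>n\<in>S. c n * cis (of_int n * t)) = 0}"
  shows "(\<Sum>n\<in>S. c n * cis (of_int n * t)) = 0"
proof -
  obtain N :: int where N: "\<And>n. n \<in> S \<Longrightarrow> - N \<le> n"
    by (rule that[of "\<Sum>n\<in>S. \<bar>n\<bar>"]) 
      (use \<open>finite S\<close> member_le_sum[of _ S abs] in \<open>fastforce simp: abs_le_iff\<close>)
  define p where "p = (\<Sum>n\<in>S. monom (c n) (nat (n + N)))"
  have p: "poly p (cis t) = cis (of_int N * t) * (\<Sum>n\<in>S. c n * cis (of_int n * t))" for t
  proof -
    have "cis t ^ nat (n + N) = cis (of_int N * t + of_int n * t)" if "n \<in> S" for n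
    proof -
      have "real (nat (n + N)) = of_int N + of_int n" using N[OF that] by simp
      thus ?thesis by (simp only: Complex.DeMoivre distrib_right)
    qed
    thus ?thesis
      by (auto simp: p_def poly_sum poly_monom sum_distrib_left cis_mult mult.left_commute
          intro!: sum.cong)
  qed
  have "infinite (cis ` {t \<in> {0..<2 * pi}. (\<Sum>n\<in>S. c n * cis (of_int n * t)) = 0})"
  proof (subst finite_image_iff)
    show "inj_on cis {t \<in> {0..<2 * pi}. (\<Sum>n\<in>S. c n * cis (of_int n * t)) = 0}"
      by (rule inj_on_subset[OF inj_on_inverseI[of "{0..<2*pi}" Arg2pi]])
         (auto intro!: Arg2pi_unique[of 1] simp: cis_conv_exp)
  qed (rule inf)
  moreover have "cis ` {t \<in> {0..<2 * pi}. (\<Sum>n\<in>S. c n * cis (of_int n * t)) = 0} \<subseteq> {z. poly p z = 0}"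
    by (auto simp: p)
  ultimately have "p = 0" using poly_roots_finite finite_subset by blast
  thus ?thesis using p[of t] by simp
qed

section \<open>Gaussians and their Fourier transforms\<close>

text \<open>The parameter is the inverse width: large values concentrate the function near the
  origin. The function is left unnormalized, with value 1 at the origin, because it serves both as an
  approximate identity and as a cutoff that tends to the constant 1.\<close>

definition gauss :: "real \<Rightarrow> 'a::euclidean_space \<Rightarrow> real" where
  "gauss s x = exp (- (s\<^sup>2 * (norm x)\<^sup>2) / 2)"

lemma gauss_nonneg [simp]: "0 \<le> gauss s x" by (simp add: gauss_def)

lemma gauss_le_1: "gauss s x \<le> 1" by (simp add: gauss_def)

lemma gauss_measurable [measurable]: "gauss s \<in> borel_measurable borel"
  unfolding gauss_def by measurable

lemma fixes f :: "'a::euclidean_space \<Rightarrow> real \<Rightarrow> complex"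
  assumes "\<And>b. b \<in> Basis \<Longrightarrow> integrable lborel (f b)"
  shows integrable_lborel_prod_Basis: "integrable lborel (\<lambda>x. \<Prod>b\<in>Basis. f b (x \<bullet> b))"
    and integral_lborel_prod_Basis:
      "(LINT x|lborel. (\<Prod>b\<in>Basis. f b (x \<bullet> b))) = (\<Prod>b\<in>Basis. (LINT t|lborel. f b t))"
proof -
  interpret product_sigma_finite "\<lambda>_::'a. lborel :: real measure" by standard
  have [measurable]: "f b \<in> borel_measurable borel" if "b \<in> Basis" for b
    using borel_measurable_integrable[OF assms[OF that]] by simp
  have m: "(\<lambda>x. \<Prod>b\<in>Basis. f b (x \<bullet> b)) \<in> borel_measurable borel"
    by measurable
  have m2: "(\<lambda>u. \<Sum>b\<in>Basis. u b *\<^sub>R b) \<in> measurable (\<Pi>\<^sub>M b\<in>(Basis::'a set). lborel) borel"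
    by measurable
  have eq: "(\<Prod>b\<in>Basis. f b ((\<Sum>b\<in>Basis. u b *\<^sub>R b) \<bullet> b)) = (\<Prod>b\<in>Basis. f b (u b))" for u :: "'a \<Rightarrow> real"
    by (intro prod.cong refl) simp
  show "integrable lborel (\<lambda>x. \<Prod>b\<in>Basis. f b (x \<bullet> b))"
    by (subst lborel_eq, subst integrable_distr_eq[OF m2 m])
       (simp only: eq, intro product_integrable_prod assms finite_Basis)
  show "(LINT x|lborel. (\<Prod>b\<in>Basis. f b (x \<bullet> b))) = (\<Prod>b\<in>Basis. (LINT t|lborel. f b t))"
    by (subst lborel_eq, subst integral_distr[OF m2 m])
       (simp only: eq, intro product_integral_prod assms finite_Basis)
qed

text \<open>After rescaling by \<open>s\<close>, and up to normalization, the integral is the characteristic function of the standard normal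
  distribution.\<close>

lemma fixes t s :: real
  assumes s: "s > 0"
  shows gauss_iexp_integrable_real: "integrable lborel (\<lambda>x. of_real (gauss s x) * iexp (t * x))" (is "integrable _ ?F")
    and gauss_iexp_integral_real:
      "(LINT x|lborel. of_real (gauss s x) * iexp (t * x)) = of_real (sqrt (2 * pi) / s * exp (- (t\<^sup>2 / s\<^sup>2) / 2))"
proof -
  define G where "G = (\<lambda>x. of_real (std_normal_density x) * iexp (t / s * x))"
  have "integrable lborel (\<lambda>x. std_normal_density x *\<^sub>R iexp (t / s * x))"
    by (rule Bochner_Integration.integrable_bound[OF integrable_normal_density[of 1 0]]) (auto simp: norm_mult)
  hence iG: "integrable lborel G" by (simp add: G_def scaleR_conv_of_real)
  have eq: "?F x = of_real (sqrt (2 * pi)) * G (0 + s * x)" for x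
    using s by (simp add: gauss_def G_def std_normal_density_def power_mult_distrib)
  show "integrable lborel ?F"
    unfolding eq using s iG
    by (intro integrable_mult_right) (simp add: lborel_integrable_real_affine_iff del: add_0)
  have "(LINT x|lborel. G x) = (LINT x|std_normal_distribution. iexp (t / s * x))"
    by (subst integral_density) (auto simp: G_def scaleR_conv_of_real)
  also have "\<dots> = of_real (exp (- ((t / s)\<^sup>2) / 2))"
    using fun_cong[OF char_std_normal_distribution, of "t / s"] by (simp add: char_def)
  finally have IG: "(LINT x|lborel. G x) = of_real (exp (- ((t / s)\<^sup>2) / 2))" .
  have "(LINT x|lborel. G x) = s * (LINT x|lborel. G (0 + s * x))"
    using lborel_integral_real_affine[of s G 0] s by (simp add: scaleR_conv_of_real)
  hence "(LINT x|lborel. ?F x) = of_real (sqrt (2 * pi)) * ((LINT x|lborel. G x) / s)"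
    unfolding eq using s by simp
  also have "\<dots> = of_real (sqrt (2 * pi) / s * exp (- (t\<^sup>2 / s\<^sup>2) / 2))"
    unfolding IG by (simp add: power_divide)
  finally show "(LINT x|lborel. ?F x) = of_real (sqrt (2 * pi) / s * exp (- (t\<^sup>2 / s\<^sup>2) / 2))" .
qed

lemma norm_sq_Basis: "(norm (x::'a::euclidean_space))\<^sup>2 = (\<Sum>b\<in>Basis. (x \<bullet> b)\<^sup>2)"
  by (subst power2_norm_eq_inner, subst euclidean_inner) (simp add: power2_eq_square)

text \<open>Both the Gaussian and the character factor over the coordinates, which reduces the
  Fourier transform of a Gaussian to dimension one.\<close>

lemma fixes y :: "'a::euclidean_space"
  assumes s: "s > 0"
  shows gauss_iexp_integrable: "integrable lborel (\<lambda>x. of_real (gauss s x) * iexp (y \<bullet> x))"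
    and gauss_iexp_integral:
      "(LINT x|lborel. of_real (gauss s x) * iexp (y \<bullet> x)) = of_real ((sqrt (2 * pi) / s) ^ DIM('a) * gauss (1 / s) y)"
proof -
  have eq: "of_real (gauss s x) * iexp (y \<bullet> x)
      = (\<Prod>b\<in>Basis. of_real (gauss s (x \<bullet> b)) * iexp ((y \<bullet> b) * (x \<bullet> b)))" for x
  proof -
    have "of_real (gauss s x) = (\<Prod>b\<in>Basis. complex_of_real (gauss s (x \<bullet> b)))"
      unfolding gauss_def norm_sq_Basis of_real_prod[symmetric]
      by (subst exp_sum[symmetric]) (simp_all add: sum_distrib_left sum_negf sum_divide_distrib)
    moreover have "iexp (y \<bullet> x) = (\<Prod>b\<in>Basis. iexp ((y \<bullet> b) * (x \<bullet> b)))"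
      by (subst exp_sum[symmetric], simp, subst euclidean_inner) (simp add: sum_distrib_left)
    ultimately show ?thesis by (simp add: prod.distrib)
  qed
  note i = gauss_iexp_integrable_real[OF s]
  show "integrable lborel (\<lambda>x. of_real (gauss s x) * iexp (y \<bullet> x))"
    unfolding eq by (rule integrable_lborel_prod_Basis[OF i])
  have "(LINT x|lborel. of_real (gauss s x) * iexp (y \<bullet> x))
     = (\<Prod>b\<in>Basis. of_real (sqrt (2 * pi) / s * exp (- ((y \<bullet> b)\<^sup>2 / s\<^sup>2) / 2)))"
    unfolding eq by (subst integral_lborel_prod_Basis[OF i]) (simp only: gauss_iexp_integral_real[OF s])
  also have "\<dots> = of_real ((sqrt (2 * pi) / s) ^ DIM('a) * (\<Prod>b\<in>Basis. exp (- ((y \<bullet> b)\<^sup>2 / s\<^sup>2) / 2)))"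
    by (simp only: of_real_prod[symmetric] prod.distrib prod_constant)
  also have "(\<Prod>b\<in>Basis. exp (- ((y \<bullet> b)\<^sup>2 / s\<^sup>2) / 2)) = gauss (1 / s) y"
    unfolding gauss_def norm_sq_Basis
    by (subst exp_sum[symmetric]) (simp_all add: sum_distrib_left sum_negf sum_divide_distrib power_divide)
  finally show "(LINT x|lborel. of_real (gauss s x) * iexp (y \<bullet> x)) = of_real ((sqrt (2 * pi) / s) ^ DIM('a) * gauss (1 / s) y)" .
qed

lemma gauss_integrable: "s > 0 \<Longrightarrow> integrable lborel (gauss s :: 'a::euclidean_space \<Rightarrow> real)"
  using integrable_Re[OF gauss_iexp_integrable[of s "0 :: 'a"]] by simp

lemma gauss_integral:
  assumes "s > 0"
  shows "(LINT x::'a::euclidean_space|lborel. gauss s x) = (sqrt (2 * pi) / s) ^ DIM('a)"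
proof -
  have "complex_of_real (LINT x::'a|lborel. gauss s x) = of_real ((sqrt (2 * pi) / s) ^ DIM('a))"
    using gauss_iexp_integral[OF assms, of "0 :: 'a"]
    by (simp add: gauss_def del: of_real_mult of_real_power)
  thus ?thesis by (simp only: of_real_eq_iff)
qed

lemma gauss_translate_integrable:
  assumes "s > 0"
  shows "integrable lborel (\<lambda>y. gauss s (y - x))"
proof -
  have "integrable (distr lborel borel ((+) (- x))) (gauss s)"
    unfolding lborel_distr_plus using assms by (rule gauss_integrable)
  thus ?thesis by (subst (asm) integrable_distr_eq) auto
qed

text \<open>Squares of Gaussians are Gaussians, so integrability already gives square
  integrability.\<close>

lemma gauss_sq: "(gauss s x)\<^sup>2 = gauss (sqrt 2 * s) x"
  unfolding gauss_def by (simp add: power_mult_distrib flip: exp_double)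

lemma lborel_affine_integral:
  fixes F :: "'a::euclidean_space \<Rightarrow> complex"
  assumes [measurable]: "F \<in> borel_measurable borel" and c: "c > 0"
  shows "(LINT y|lborel. F y) = of_real (c ^ DIM('a)) * (LINT z|lborel. F (t + c *\<^sub>R z))"
  using c
  by (subst lborel_affine[of c t]) (simp_all add: integral_density integral_distr scaleR_conv_of_real)

section \<open>The Fourier transform on L2 tested against Gaussians\<close>

lemma L2_mult_integrable:
  assumes "square_integrable M f" "square_integrable M g"
  shows "integrable M (\<lambda>x. f x * g x)"
proof (rule Bochner_Integration.integrable_bound)
  show "integrable M (\<lambda>x. (norm (f x))\<^sup>2 + (norm (g x))\<^sup>2)"
    using assms by (auto simp: square_integrable_def)
  show "(\<lambda>x. f x * g x) \<in> borel_measurable M"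
    using assms by (auto simp: square_integrable_def)
  have "a * b \<le> a\<^sup>2 + b\<^sup>2" if "a \<ge> 0" "b \<ge> 0" for a b :: real
    using sum_squares_bound[of a b] that mult_nonneg_nonneg[of a b] by linarith
  thus "AE x in M. norm (f x * g x) \<le> norm ((norm (f x))\<^sup>2 + (norm (g x))\<^sup>2)"
    by (simp add: norm_mult)
qed

text \<open>Pairing with a fixed square integrable function is continuous for the L2 distance, by
  the Cauchy-Schwarz inequality. The products are assumed integrable instead of the functions
  \<open>h n\<close> being square integrable, because the lemma is also applied to Fourier integrals, for which
  only the products are known to be integrable.\<close>

lemma L2_limit_integral:
  assumes "\<And>n. h n \<in> borel_measurable M" and "f \<in> borel_measurable M"
    and lim: "(\<lambda>n. \<integral>\<^sup>+x. ennreal ((norm (h n x - f x))\<^sup>2) \<partial>M) \<longlonglongrightarrow> 0"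
    and \<psi>: "square_integrable M \<psi>"
    and ih: "\<And>n. integrable M (\<lambda>x. h n x * \<psi> x)" and ig: "integrable M (\<lambda>x. f x * \<psi> x)"
  shows "(\<lambda>n. LINT x|M. h n x * \<psi> x) \<longlonglongrightarrow> (LINT x|M. f x * \<psi> x)"
proof -
  have [measurable]: "\<And>n. h n \<in> borel_measurable M" "f \<in> borel_measurable M" "\<psi> \<in> borel_measurable M"
    using assms by (auto simp: square_integrable_def)
  define C where "C = (\<integral>\<^sup>+x. ennreal ((norm (\<psi> x))\<^sup>2) \<partial>M)"
  define D where "D = (\<lambda>n. \<integral>\<^sup>+x. ennreal ((norm (h n x - f x))\<^sup>2) \<partial>M)"
  define E where "E = (\<lambda>n. (LINT x|M. h n x * \<psi> x) - (LINT x|M. f x * \<psi> x))"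
  have C: "C < \<infinity>" using \<psi> unfolding C_def square_integrable_def by (simp add: integrable_iff_bounded)
  have "ennreal ((norm (E n))\<^sup>2) \<le> D n * C" for n
  proof -
    have "E n = (LINT x|M. (h n x - f x) * \<psi> x)"
      unfolding E_def left_diff_distrib by (intro Bochner_Integration.integral_diff[symmetric] ih ig)
    hence "ennreal (norm (E n)) \<le> (\<integral>\<^sup>+x. ennreal (norm ((h n x - f x) * \<psi> x)) \<partial>M)"
      using integral_norm_bound_ennreal[of M "\<lambda>x. (h n x - f x) * \<psi> x"] ih ig
      by (simp add: left_diff_distrib)
    hence "(ennreal (norm (E n)))\<^sup>2 \<le> (\<integral>\<^sup>+x. ennreal (norm (h n x - f x)) * ennreal (norm (\<psi> x)) \<partial>M)\<^sup>2"
      by (intro power_mono) (simp_all add: norm_mult ennreal_mult)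
    also have "\<dots> \<le> D n * C"
      unfolding C_def D_def ennreal_power[OF norm_ge_zero, symmetric]
      by (rule Cauchy_Schwarz_nn_integral) auto
    finally show ?thesis by (simp add: ennreal_power)
  qed
  moreover have "(\<lambda>n. D n * C) \<longlonglongrightarrow> 0 * C"
    by (intro tendsto_mult_ennreal tendsto_const) (use lim C in \<open>auto simp: D_def\<close>)
  ultimately have "(\<lambda>n. ennreal ((norm (E n))\<^sup>2)) \<longlonglongrightarrow> ennreal 0"
    by - (rule tendsto_sandwich[where f = "\<lambda>_. 0" and h = "\<lambda>n. D n * C"], simp_all)
  hence "(\<lambda>n. (norm (E n))\<^sup>2) \<longlonglongrightarrow> 0"
    by (rule tendsto_ennrealD) auto
  hence "(\<lambda>n. sqrt ((norm (E n))\<^sup>2)) \<longlonglongrightarrow> sqrt 0" by (rule tendsto_real_sqrt)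
  hence "E \<longlonglongrightarrow> 0" by (simp add: tendsto_norm_zero_iff)
  thus ?thesis unfolding E_def by (rule Lim_null[THEN iffD2])
qed

lemma fourier_integral_measurable [measurable]:
  assumes [measurable]: "h \<in> borel_measurable borel"
  shows "fourier_integral h \<in> borel_measurable borel"
  unfolding fourier_integral_def[abs_def] by measurable

lemma fourier_integral_norm_le: "norm (fourier_integral h \<xi>) \<le> (LINT x|lborel. norm (h x))"
  unfolding fourier_integral_def
  by (rule order_trans[OF integral_norm_bound]) (simp add: norm_mult)

lemma fourier_integral_mult_integrable:
  assumes "integrable lborel h" "integrable lborel \<phi>"
  shows "integrable lborel (\<lambda>\<xi>. fourier_integral h \<xi> * \<phi> \<xi>)"
proof (rule Bochner_Integration.integrable_bound)
  show "integrable lborel (\<lambda>\<xi>. (LINT x|lborel. norm (h x)) * norm (\<phi> \<xi>))"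
    using assms by auto
  show "(\<lambda>\<xi>. fourier_integral h \<xi> * \<phi> \<xi>) \<in> borel_measurable lborel"
    using assms[THEN borel_measurable_integrable] by simp
  have "(LINT x|lborel. norm (h x)) \<ge> 0" by simp
  thus "AE \<xi> in lborel. norm (fourier_integral h \<xi> * \<phi> \<xi>) \<le> norm ((LINT x|lborel. norm (h x)) * norm (\<phi> \<xi>))"
    by (intro AE_I2) (simp add: norm_mult mult_right_mono fourier_integral_norm_le)
qed

text \<open>Both sides are the double integral of \<open>h x * \<phi> \<xi> * exp (- \<i> \<xi> \<bullet> x)\<close>, taken in the two
  orders.\<close>

lemma fourier_multiplication_formula:
  fixes h \<phi> :: "real^'d \<Rightarrow> complex"
  assumes h: "integrable lborel h" and \<phi>: "integrable lborel \<phi>"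
  shows "(LINT \<xi>|lborel. fourier_integral h \<xi> * \<phi> \<xi>) = (LINT x|lborel. h x * fourier_integral \<phi> x)"
proof -
  have [measurable]: "h \<in> borel_measurable borel" "\<phi> \<in> borel_measurable borel"
    using assms[THEN borel_measurable_integrable] by simp_all
  let ?k = "\<lambda>x \<xi>. h x * \<phi> \<xi> * exp (- (\<i> * of_real (\<xi> \<bullet> x)))"
  have "integrable (lborel \<Otimes>\<^sub>M lborel) (case_prod ?k)"
  proof (rule lborel_pair.Fubini_integrable)
    show "integrable lborel (\<lambda>x. LINT \<xi>|lborel. norm (case_prod ?k (x, \<xi>)))"
      using h by (simp add: norm_mult)
    show "AE x in lborel. integrable lborel (\<lambda>\<xi>. case_prod ?k (x, \<xi>))"
    proof (intro AE_I2)
      fix x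
      have "integrable lborel (\<lambda>\<xi>. norm (h x) * norm (\<phi> \<xi>))" using \<phi> by auto
      thus "integrable lborel (\<lambda>\<xi>. case_prod ?k (x, \<xi>))"
        by (rule Bochner_Integration.integrable_bound) (auto simp: norm_mult)
    qed
  qed simp
  from lborel_pair.Fubini_integral[OF this]
  have "(LINT \<xi>|lborel. (LINT x|lborel. ?k x \<xi>)) = (LINT x|lborel. (LINT \<xi>|lborel. ?k x \<xi>))" .
  moreover have "(LINT x|lborel. ?k x \<xi>) = fourier_integral h \<xi> * \<phi> \<xi>" for \<xi>
    unfolding fourier_integral_def by (simp add: mult_ac flip: integral_mult_right_zero)
  moreover have "(LINT \<xi>|lborel. ?k x \<xi>) = h x * fourier_integral \<phi> x" for x
    unfolding fourier_integral_def by (simp add: mult_ac inner_commute flip: integral_mult_right_zero)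
  ultimately show ?thesis by simp
qed

text \<open>The multiplication formula, applied to the approximating functions \<open>h n\<close> and to a modulated
  Gaussian \<open>\<phi>\<close>, passes to the L2 limit on both sides, since \<open>\<phi>\<close> and its explicitly known Fourier
  transform are both square integrable. This is where the definition of the L2 Fourier transform by
  approximation enters.\<close>

lemma fourier_transform_gauss_pairing:
  fixes f g :: "real^'d \<Rightarrow> complex"
  assumes fg: "has_fourier_transform_L2 f g" and r: "r > 0"
  shows "(LINT \<xi>|lborel. g \<xi> * (of_real (gauss (1 / r) \<xi>) * iexp (x \<bullet> \<xi>)))
       = of_real (sqrt (2 * pi) ^ CARD('d)) * (of_real (r ^ CARD('d)) * (LINT y|lborel. f y * of_real (gauss r (y - x))))"
proof -
  from fg obtain h where f: "square_integrable lborel f" and g: "square_integrable lborel g"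
    and h: "\<And>n. integrable lborel (h n)" "\<And>n. square_integrable lborel (h n)"
    and lim: "(\<lambda>n. L2_dist_sq (h n) f) \<longlonglongrightarrow> 0" "(\<lambda>n. L2_dist_sq (fourier_integral (h n)) g) \<longlonglongrightarrow> 0"
    unfolding has_fourier_transform_L2_def by blast
  have [measurable]: "f \<in> borel_measurable borel" "g \<in> borel_measurable borel" "\<And>n. h n \<in> borel_measurable borel"
    using f g h by (auto simp: square_integrable_def)
  define \<phi> where "\<phi> = (\<lambda>\<xi>. of_real (gauss (1 / r) \<xi>) * iexp (x \<bullet> \<xi>))"
  have [measurable]: "\<phi> \<in> borel_measurable borel" unfolding \<phi>_def by measurable
  have i\<phi>: "integrable lborel \<phi>" unfolding \<phi>_def using r by (intro gauss_iexp_integrable) simp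
  have norm\<phi>: "(norm (\<phi> \<xi>))\<^sup>2 = gauss (sqrt 2 * (1 / r)) \<xi>" for \<xi>
    unfolding \<phi>_def by (simp add: norm_mult gauss_sq)
  have \<phi>2: "square_integrable lborel \<phi>"
    unfolding square_integrable_def norm\<phi> using r by (auto intro!: gauss_integrable)
  define c where "c = complex_of_real ((sqrt (2 * pi) * r) ^ CARD('d))"
  have \<phi>hat: "fourier_integral \<phi> y = c * of_real (gauss r (y - x))" for y
  proof -
    have "fourier_integral \<phi> y = (LINT \<xi>|lborel. of_real (gauss (1 / r) \<xi>) * iexp ((x - y) \<bullet> \<xi>))"
      unfolding fourier_integral_def \<phi>_def
      by (simp add: mult.assoc inner_diff_left right_diff_distrib flip: exp_add)
    also have "\<dots> = of_real ((sqrt (2 * pi) / (1 / r)) ^ DIM(real^'d) * gauss (1 / (1 / r)) (x - y))"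
      using r by (intro gauss_iexp_integral) simp
    also have "\<dots> = c * of_real (gauss r (y - x))"
      by (simp add: c_def gauss_def norm_minus_commute)
    finally show ?thesis .
  qed
  have \<phi>hat2: "square_integrable lborel (fourier_integral \<phi>)"
  proof -
    have "integrable lborel (\<lambda>y. gauss (sqrt 2 * r) (y - x))"
      using r by (intro gauss_translate_integrable) simp
    thus ?thesis unfolding square_integrable_def \<phi>hat
      by (simp add: norm_mult power_mult_distrib gauss_sq)
  qed
  have "(\<lambda>n. LINT \<xi>|lborel. fourier_integral (h n) \<xi> * \<phi> \<xi>) \<longlonglongrightarrow> (LINT \<xi>|lborel. g \<xi> * \<phi> \<xi>)"
    by (rule L2_limit_integral[OF _ _ _ \<phi>2 fourier_integral_mult_integrable[OF h(1) i\<phi>] L2_mult_integrable[OF g \<phi>2]])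
       (use lim(2) in \<open>simp_all add: L2_dist_sq_def\<close>)
  moreover have "(\<lambda>n. LINT y|lborel. h n y * fourier_integral \<phi> y) \<longlonglongrightarrow> (LINT y|lborel. f y * fourier_integral \<phi> y)"
    by (rule L2_limit_integral[OF _ _ _ \<phi>hat2 L2_mult_integrable[OF h(2) \<phi>hat2] L2_mult_integrable[OF f \<phi>hat2]])
       (use lim(1) in \<open>simp_all add: L2_dist_sq_def\<close>)
  ultimately have "(LINT \<xi>|lborel. g \<xi> * \<phi> \<xi>) = (LINT y|lborel. f y * fourier_integral \<phi> y)"
    unfolding fourier_multiplication_formula[OF h(1) i\<phi>] by (rule LIMSEQ_unique)
  also have "\<dots> = c * (LINT y|lborel. f y * of_real (gauss r (y - x)))"
    unfolding \<phi>hat by (simp add: mult.left_commute)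
  finally show ?thesis by (simp add: \<phi>_def c_def power_mult_distrib mult.assoc)
qed

section \<open>Fourier inversion\<close>

text \<open>The function is split at a small ball around \<open>x\<close>. The part inside is bounded, so after
  the substitution \<open>y = x + z / r\<close> dominated convergence applies. Outside the ball the Gaussian gains
  a factor that decays faster than any power of \<open>r\<close>, and what remains is a fixed convergent
  integral.\<close>

lemma gauss_approximate_identity:
  fixes f :: "'a::euclidean_space \<Rightarrow> complex"
  assumes f: "square_integrable lborel f" and cont: "isCont f x"
  shows "(\<lambda>n. of_real (real (Suc n) ^ DIM('a)) * (LINT y|lborel. f y * of_real (gauss (real (Suc n)) (y - x))))
          \<longlonglongrightarrow> of_real (sqrt (2 * pi) ^ DIM('a)) * f x"
proof -
  have [measurable]: "f \<in> borel_measurable borel" using f by (simp add: square_integrable_def)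
  obtain \<delta> where \<delta>: "\<delta> > 0" "\<And>y. dist y x < \<delta> \<Longrightarrow> dist (f y) (f x) < 1"
    using cont unfolding continuous_at_eps_delta by (metis zero_less_one)
  define B where "B = norm (f x) + 1"
  define f1 where "f1 = (\<lambda>y. if dist y x < \<delta> then f y else 0)"
  define f2 where "f2 = (\<lambda>y. if dist y x < \<delta> then 0 else f y)"
  have [measurable]: "f1 \<in> borel_measurable borel" "f2 \<in> borel_measurable borel"
    unfolding f1_def f2_def by measurable
  have f1B: "norm (f1 y) \<le> B" for y
    using \<delta>(2)[of y] norm_triangle_sub[of "f y" "f x"] by (auto simp: f1_def B_def dist_norm)
  have fint: "integrable lborel (\<lambda>y. f y * of_real (gauss r (y - x)))" if "r > 0" for r
    by (rule L2_mult_integrable[OF f]) (use gauss_translate_integrable[of "sqrt 2 * r" x] that in \<open>auto simp: square_integrable_def gauss_sq\<close>)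
  have f1int: "integrable lborel (\<lambda>y. f1 y * of_real (gauss r (y - x)))" if "r > 0" for r
    by (rule Bochner_Integration.integrable_bound[OF fint[OF that]]) (auto simp: f1_def)
  have f2int: "integrable lborel (\<lambda>y. f2 y * of_real (gauss r (y - x)))" if "r > 0" for r
    by (rule Bochner_Integration.integrable_bound[OF fint[OF that]]) (auto simp: f2_def)
  have near: "(\<lambda>n. of_real (real (Suc n) ^ DIM('a)) * (LINT y|lborel. f1 y * of_real (gauss (real (Suc n)) (y - x))))
          \<longlonglongrightarrow> of_real (sqrt (2 * pi) ^ DIM('a)) * f x"
  proof -
    have eq: "of_real (r ^ DIM('a)) * (LINT y|lborel. f1 y * of_real (gauss r (y - x)))
       = (LINT z|lborel. f1 (x + (1 / r) *\<^sub>R z) * of_real (gauss 1 z))" if r: "r > 0" for r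
    proof -
      have "gauss r ((1 / r) *\<^sub>R z) = gauss 1 z" for z :: 'a
        using r by (simp add: gauss_def power_mult_distrib power_divide)
      thus ?thesis
        using r by (subst lborel_affine_integral[of _ "1 / r" x]) (auto simp: power_divide)
    qed
    have "(\<lambda>n. LINT z|lborel. f1 (x + (1 / real (Suc n)) *\<^sub>R z) * of_real (gauss 1 z))
        \<longlonglongrightarrow> (LINT z|lborel. f x * of_real (gauss 1 (z::'a)))"
    proof (rule integral_dominated_convergence)
      show "integrable lborel (\<lambda>z. B * gauss 1 (z::'a))"
        by (intro integrable_mult_right gauss_integrable) simp
      show "AE z in lborel. (\<lambda>n. f1 (x + (1 / real (Suc n)) *\<^sub>R z) * of_real (gauss 1 z)) \<longlonglongrightarrow> f x * of_real (gauss 1 z)"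
      proof (intro AE_I2 tendsto_mult tendsto_const)
        fix z :: 'a
        have "isCont f1 x"
        proof -
          have "eventually (\<lambda>y. dist y x < \<delta>) (nhds x)"
            using \<delta>(1) by (auto simp: eventually_nhds_metric)
          hence "eventually (\<lambda>y. f1 y = f y) (nhds x)"
            by eventually_elim (simp add: f1_def)
          thus ?thesis using cont by (simp add: isCont_cong)
        qed
        moreover have "(\<lambda>n. x + (1 / real (Suc n)) *\<^sub>R z) \<longlonglongrightarrow> x + 0 *\<^sub>R z"
          by (intro tendsto_intros LIMSEQ_Suc lim_1_over_n)
        ultimately have "(\<lambda>n. f1 (x + (1 / real (Suc n)) *\<^sub>R z)) \<longlonglongrightarrow> f1 x"
          by (intro isCont_tendsto_compose[of _ f1]) auto
        thus "(\<lambda>n. f1 (x + (1 / real (Suc n)) *\<^sub>R z)) \<longlonglongrightarrow> f x"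
          using \<delta>(1) by (simp add: f1_def)
      qed
      show "AE z in lborel. norm (f1 (x + (1 / real (Suc n)) *\<^sub>R z) * of_real (gauss 1 z)) \<le> B * gauss 1 z" for n
        by (intro AE_I2) (simp add: norm_mult mult_right_mono f1B del: of_nat_Suc)
    qed measurable
    moreover have "(LINT z|lborel. f x * of_real (gauss 1 (z::'a))) = of_real (sqrt (2 * pi) ^ DIM('a)) * f x"
      by (simp add: gauss_integral)
    ultimately show ?thesis by (simp only: eq[OF of_nat_0_less_iff[THEN iffD2, OF zero_less_Suc]])
  qed
  define L where "L = (LINT y|lborel. norm (f y) * gauss 1 (y - x))"
  have far: "(\<lambda>n. of_real (real (Suc n) ^ DIM('a)) * (LINT y|lborel. f2 y * of_real (gauss (real (Suc n)) (y - x))))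
          \<longlonglongrightarrow> 0"
  proof (rule Lim_null_comparison)
    let ?b = "\<lambda>n. real (Suc n) ^ DIM('a) * (exp (- (((real (Suc n))\<^sup>2 - 1) * \<delta>\<^sup>2) / 2) * L)"
    show "eventually (\<lambda>n. norm (of_real (real (Suc n) ^ DIM('a)) * (LINT y|lborel. f2 y * of_real (gauss (real (Suc n)) (y - x)))) \<le> ?b n) sequentially"
    proof (intro always_eventually allI)
      fix n
      define r where "r = real (Suc n)"
      have r: "r \<ge> 1" by (simp add: r_def)
      have "norm (LINT y|lborel. f2 y * of_real (gauss r (y - x)))
         \<le> (LINT y|lborel. exp (- ((r\<^sup>2 - 1) * \<delta>\<^sup>2) / 2) * (norm (f y) * gauss 1 (y - x)))"
      proof (rule Bochner_Integration.integral_norm_bound_integral)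
        show "integrable lborel (\<lambda>y. f2 y * of_real (gauss r (y - x)))"
          using r by (intro f2int) simp
        show "integrable lborel (\<lambda>y. exp (- ((r\<^sup>2 - 1) * \<delta>\<^sup>2) / 2) * (norm (f y) * gauss 1 (y - x)))"
          using integrable_norm[OF fint[of 1]] by (simp add: norm_mult)
        fix y
        have "gauss r (y - x) \<le> exp (- ((r\<^sup>2 - 1) * \<delta>\<^sup>2) / 2) * gauss 1 (y - x)" if "\<not> dist y x < \<delta>"
        proof -
          have "\<delta>\<^sup>2 \<le> (norm (y - x))\<^sup>2" using that \<delta>(1) by (intro power_mono) (auto simp: dist_norm)
          moreover have "r\<^sup>2 - 1 \<ge> 0" using r by simp
          ultimately have "(r\<^sup>2 - 1) * \<delta>\<^sup>2 \<le> (r\<^sup>2 - 1) * (norm (y - x))\<^sup>2" by (rule mult_left_mono)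
          moreover have "(r\<^sup>2 - 1) * (norm (y - x))\<^sup>2 = r\<^sup>2 * (norm (y - x))\<^sup>2 - (norm (y - x))\<^sup>2"
            by (simp add: left_diff_distrib)
          ultimately show ?thesis unfolding gauss_def exp_add[symmetric] exp_le_cancel_iff
            by simp
        qed
        hence "norm (f2 y) * gauss r (y - x) \<le> norm (f y) * (exp (- ((r\<^sup>2 - 1) * \<delta>\<^sup>2) / 2) * gauss 1 (y - x))"
          by (cases "dist y x < \<delta>") (simp_all add: f2_def mult_left_mono)
        thus "norm (f2 y * of_real (gauss r (y - x))) \<le> exp (- ((r\<^sup>2 - 1) * \<delta>\<^sup>2) / 2) * (norm (f y) * gauss 1 (y - x))"
          by (simp only: norm_mult norm_of_real abs_of_nonneg[OF gauss_nonneg] mult.left_commute)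
      qed
      also have "\<dots> = exp (- ((r\<^sup>2 - 1) * \<delta>\<^sup>2) / 2) * L" by (simp add: L_def)
      finally have "r ^ DIM('a) * norm (LINT y|lborel. f2 y * of_real (gauss r (y - x)))
          \<le> r ^ DIM('a) * (exp (- ((r\<^sup>2 - 1) * \<delta>\<^sup>2) / 2) * L)"
        using r by (intro mult_left_mono) auto
      thus "norm (of_real (real (Suc n) ^ DIM('a)) * (LINT y|lborel. f2 y * of_real (gauss (real (Suc n)) (y - x)))) \<le> ?b n"
        unfolding r_def[symmetric] using r by (simp add: norm_mult norm_power)
    qed
    have "(\<lambda>n. real (Suc n) ^ DIM('a) * exp (- (((real (Suc n))\<^sup>2 - 1) * \<delta>\<^sup>2) / 2)) \<longlonglongrightarrow> 0"
      using \<delta>(1) by real_asymp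
    from tendsto_mult_left_zero[OF this, of L] show "?b \<longlonglongrightarrow> 0" by (simp add: mult.assoc)
  qed
  have "(LINT y|lborel. f y * of_real (gauss r (y - x)))
      = (LINT y|lborel. f1 y * of_real (gauss r (y - x))) + (LINT y|lborel. f2 y * of_real (gauss r (y - x)))"
    if "r > 0" for r
    by (subst Bochner_Integration.integral_add[OF f1int f2int, symmetric])
       (use that in \<open>auto intro!: Bochner_Integration.integral_cong simp: f1_def f2_def\<close>)
  thus ?thesis using tendsto_add[OF near far] by (simp add: distrib_left del: of_nat_Suc)
qed

text \<open>Let the Gaussian in \<open>fourier_transform_gauss_pairing\<close> tend to the constant 1 on the
  frequency side; on the other side it becomes an approximate identity.\<close>

lemma fourier_inversion_integrable:
  fixes f g :: "real^'d \<Rightarrow> complex"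
  assumes fg: "has_fourier_transform_L2 f g" and cont: "isCont f x" and g: "integrable lborel g"
  shows "of_real ((2 * pi) ^ CARD('d)) * f x = (LINT \<xi>|lborel. g \<xi> * iexp (x \<bullet> \<xi>))"
proof -
  have [measurable]: "g \<in> borel_measurable borel" using g by auto
  have f: "square_integrable lborel f" using fg by (simp add: has_fourier_transform_L2_def)
  have "(\<lambda>n. LINT \<xi>|lborel. g \<xi> * (of_real (gauss (1 / real (Suc n)) \<xi>) * iexp (x \<bullet> \<xi>)))
      \<longlonglongrightarrow> (LINT \<xi>|lborel. g \<xi> * (of_real 1 * iexp (x \<bullet> \<xi>)))"
  proof (rule integral_dominated_convergence)
    show "integrable lborel (\<lambda>\<xi>. norm (g \<xi>))" using g by simp
    have "(\<lambda>n. gauss (1 / real (Suc n)) \<xi>) \<longlonglongrightarrow> exp (- (0\<^sup>2 * (norm \<xi>)\<^sup>2) / 2)" for \<xi> :: "real^'d"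
      unfolding gauss_def by (intro tendsto_intros LIMSEQ_Suc lim_1_over_n) simp
    thus "AE \<xi> in lborel. (\<lambda>n. g \<xi> * (of_real (gauss (1 / real (Suc n)) \<xi>) * iexp (x \<bullet> \<xi>)))
        \<longlonglongrightarrow> g \<xi> * (of_real 1 * iexp (x \<bullet> \<xi>))"
      by (intro AE_I2 tendsto_intros) simp
    show "AE \<xi> in lborel. norm (g \<xi> * (of_real (gauss (1 / real (Suc n)) \<xi>) * iexp (x \<bullet> \<xi>))) \<le> norm (g \<xi>)" for n
      by (intro AE_I2) (simp add: norm_mult mult_left_le gauss_le_1 del: of_nat_Suc)
  qed measurable
  moreover have "(\<lambda>n. LINT \<xi>|lborel. g \<xi> * (of_real (gauss (1 / real (Suc n)) \<xi>) * iexp (x \<bullet> \<xi>)))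
      \<longlonglongrightarrow> of_real (sqrt (2 * pi) ^ CARD('d)) * (of_real (sqrt (2 * pi) ^ CARD('d)) * f x)"
    unfolding fourier_transform_gauss_pairing[OF fg of_nat_0_less_iff[THEN iffD2, OF zero_less_Suc]]
    using tendsto_mult_left[OF gauss_approximate_identity[OF f cont]]
    by (simp only: DIM_cart DIM_real mult_1_right)
  ultimately have "(LINT \<xi>|lborel. g \<xi> * (of_real 1 * iexp (x \<bullet> \<xi>)))
      = of_real (sqrt (2 * pi) ^ CARD('d)) * (of_real (sqrt (2 * pi) ^ CARD('d)) * f x)"
    by (rule LIMSEQ_unique)
  also have "\<dots> = of_real ((sqrt (2 * pi) * sqrt (2 * pi)) ^ CARD('d)) * f x"
    by (simp only: power_mult_distrib of_real_mult mult.assoc)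
  also have "sqrt (2 * pi) * sqrt (2 * pi) = 2 * pi" by simp
  finally show ?thesis by simp
qed

section \<open>Analyticity of band-limited functions\<close>

text \<open>On the line through \<open>x\<close> and a point \<open>x0\<close> of \<open>U\<close>, the inverse Fourier integral extends to
  a function \<open>\<Phi>\<close> of a complex parameter. Expanding the exponential and integrating term by term,
  which bounded frequencies permit, shows that \<open>\<Phi>\<close> is given by an everywhere convergent power
  series. Its zeros at small real parameters accumulate at 0, so all coefficients vanish.\<close>

lemma fourier_band_limited_zero_on_open:
  fixes g :: "'a::euclidean_space \<Rightarrow> complex"
  assumes g: "integrable lborel g" and supp: "\<And>\<xi>. norm \<xi> > R \<Longrightarrow> g \<xi> = 0"
    and U: "open U" "U \<noteq> {}" "\<And>x. x \<in> U \<Longrightarrow> (LINT \<xi>|lborel. g \<xi> * iexp (x \<bullet> \<xi>)) = 0"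
  shows "(LINT \<xi>|lborel. g \<xi> * iexp (x \<bullet> \<xi>)) = 0"
proof -
  have [measurable]: "g \<in> borel_measurable borel" using g by auto
  obtain x0 where x0: "x0 \<in> U" using U by auto
  define v where "v = x - x0"
  define \<Phi> where "\<Phi> = (\<lambda>z::complex. LINT \<xi>|lborel. g \<xi> * iexp (x0 \<bullet> \<xi>) * exp (\<i> * z * of_real (v \<bullet> \<xi>)))"
  define a where "a = (\<lambda>m. LINT \<xi>|lborel. g \<xi> * iexp (x0 \<bullet> \<xi>) * ((\<i> * of_real (v \<bullet> \<xi>)) ^ m / fact m))"
  have line: "\<Phi> (of_real t) = (LINT \<xi>|lborel. g \<xi> * iexp ((x0 + t *\<^sub>R v) \<bullet> \<xi>))" for t
    unfolding \<Phi>_def by (simp add: mult.assoc inner_add_left distrib_left flip: exp_add)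
  have sums: "(\<lambda>m. a m * z ^ m) sums \<Phi> z" for z
  proof -
    define F where "F = (\<lambda>m \<xi>. g \<xi> * iexp (x0 \<bullet> \<xi>) * ((\<i> * z * of_real (v \<bullet> \<xi>)) ^ m / fact m))"
    define M where "M = norm z * (norm v * \<bar>R\<bar>)"
    have F_le: "norm (F m \<xi>) \<le> norm (g \<xi>) * (M ^ m / fact m)" for m \<xi>
    proof (cases "norm \<xi> > R")
      case False
      have "norm (\<i> * z * of_real (v \<bullet> \<xi>)) \<le> M"
      proof -
        have "\<bar>v \<bullet> \<xi>\<bar> \<le> norm v * \<bar>R\<bar>"
          using Cauchy_Schwarz_ineq2[of v \<xi>] False by (smt (verit) mult_left_mono norm_ge_zero)
        thus ?thesis unfolding M_def by (simp add: norm_mult mult_left_mono)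
      qed
      hence "norm ((\<i> * z * of_real (v \<bullet> \<xi>)) ^ m / fact m) \<le> M ^ m / fact m"
        unfolding norm_divide norm_power by (simp add: divide_right_mono power_mono)
      hence "norm (g \<xi>) * norm ((\<i> * z * of_real (v \<bullet> \<xi>)) ^ m / fact m) \<le> norm (g \<xi>) * (M ^ m / fact m)"
        by (rule mult_left_mono) simp
      thus ?thesis unfolding F_def norm_mult[of "g \<xi> * _"] norm_mult[of "g \<xi>"] by simp
    qed (simp add: F_def supp)
    have [measurable]: "F m \<in> borel_measurable borel" for m unfolding F_def by measurable
    have intF: "integrable lborel (F m)" for m
    proof (rule Bochner_Integration.integrable_bound)
      show "integrable lborel (\<lambda>\<xi>. norm (g \<xi>) * (M ^ m / fact m))" using g by simp
      show "AE \<xi> in lborel. norm (F m \<xi>) \<le> norm (norm (g \<xi>) * (M ^ m / fact m))"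
        by (intro AE_I2) (simp only: real_norm_def, rule order_trans[OF F_le abs_ge_self])
    qed simp
    have "(\<lambda>m. LINT \<xi>|lborel. F m \<xi>) sums (LINT \<xi>|lborel. (\<Sum>m. F m \<xi>))"
    proof (rule sums_integral[OF intF])
      have sM: "summable (\<lambda>m. M ^ m / fact m)"
        using summable_exp[of M] by (simp add: divide_inverse mult.commute)
      show "AE \<xi> in lborel. summable (\<lambda>m. norm (F m \<xi>))"
        by (intro AE_I2 summable_comparison_test'[OF summable_mult[OF sM]]) (use F_le in auto)
      show "summable (\<lambda>m. LINT \<xi>|lborel. norm (F m \<xi>))"
      proof (rule summable_comparison_test'[OF summable_mult[OF sM]])
        fix m :: nat
        have "(LINT \<xi>|lborel. norm (F m \<xi>)) \<le> (LINT \<xi>|lborel. norm (g \<xi>) * (M ^ m / fact m))"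
          using g intF by (intro integral_mono F_le) auto
        thus "norm (LINT \<xi>|lborel. norm (F m \<xi>)) \<le> (LINT \<xi>|lborel. norm (g \<xi>)) * (M ^ m / fact m)"
          by simp
      qed
    qed
    moreover have "(LINT \<xi>|lborel. F m \<xi>) = a m * z ^ m" for m
      unfolding a_def F_def integral_mult_left_zero[symmetric]
      by (simp add: power_mult_distrib mult_ac)
    moreover have "(\<Sum>m. F m \<xi>) = g \<xi> * iexp (x0 \<bullet> \<xi>) * exp (\<i> * z * of_real (v \<bullet> \<xi>))" for \<xi>
    proof -
      let ?w = "\<i> * z * of_real (v \<bullet> \<xi>)"
      have "w ^ m /\<^sub>R fact m = w ^ m / fact m" for w :: complex and m
        by (simp add: scaleR_conv_of_real divide_inverse)
      hence "(\<lambda>m. F m \<xi>) sums (g \<xi> * iexp (x0 \<bullet> \<xi>) * exp ?w)"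
        using sums_mult[OF exp_converges[of ?w], of "g \<xi> * iexp (x0 \<bullet> \<xi>)"]
        by (simp only: F_def)
      thus ?thesis by (rule sums_unique[symmetric])
    qed
    ultimately show ?thesis by (simp add: \<Phi>_def)
  qed
  obtain \<epsilon> where \<epsilon>: "\<epsilon> > 0" "ball x0 \<epsilon> \<subseteq> U" using U(1) x0 open_contains_ball by blast
  have near0: "\<Phi> (of_real t) = 0" if "\<bar>t\<bar> * norm v < \<epsilon>" for t
    unfolding line by (rule U(3), rule subsetD[OF \<epsilon>(2)]) (use that in \<open>simp add: dist_norm\<close>)
  have \<Phi>0: "\<Phi> 0 = 0" using near0[of 0] \<epsilon>(1) by simp
  have "a m = 0" for m
  proof (rule ccontr)
    assume am: "a m \<noteq> 0"
    have "a 0 = \<Phi> 0" by (rule sums_unique2[OF powser_sums_zero sums])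
    hence "m > 0" using am \<Phi>0 by (cases m) auto
    then obtain s where s: "s > 0" "\<And>z. z \<in> cball 0 s - {0} \<Longrightarrow> \<Phi> z \<noteq> 0"
      using powser_0_nonzero[of 1 0 a \<Phi> m] sums \<Phi>0 am by auto
    \<comment> \<open>small enough that \<open>\<Phi>\<close> has no zero at \<open>t\<close>, and that \<open>x0 + t *\<^sub>R v\<close> is still in \<open>U\<close>\<close>
    define t where "t = min s (\<epsilon> / (2 * (norm v + 1)))"
    have t: "t > 0" "t \<le> s" using s(1) \<epsilon>(1) by (auto simp: t_def add_nonneg_pos)
    have "t * norm v \<le> \<epsilon> / (2 * (norm v + 1)) * norm v" by (intro mult_right_mono) (auto simp: t_def)
    also have "\<dots> < \<epsilon>" using \<epsilon>(1) by (simp add: divide_simps add_nonneg_pos)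
    finally have "\<Phi> (of_real t) = 0" using near0[of t] t by simp
    moreover have "\<Phi> (of_real t) \<noteq> 0" using s(2)[of "of_real t"] t by simp
    ultimately show False by simp
  qed
  hence "\<Phi> 1 = 0" using sums[of 1] by (simp add: sums_iff)
  thus ?thesis using line[of 1] by (simp add: v_def)
qed

text \<open>Off \<open>K\<close> there is nothing to integrate, and on \<open>K\<close> the bound \<open>t \<le> 1 + t\<^sup>2\<close> suffices.\<close>

lemma L2_compact_support_integrable:
  assumes g: "square_integrable lborel g" and K: "compact K" "AE \<xi> in lborel. \<xi> \<notin> K \<longrightarrow> g \<xi> = 0"
  shows "integrable lborel g"
proof (rule Bochner_Integration.integrable_bound)
  have "integrable lborel (indicator K :: _ \<Rightarrow> real)"
    using borel_integrable_compact[OF K(1), of "\<lambda>_. 1 :: real"] by (simp add: mult.commute)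
  thus "integrable lborel (\<lambda>\<xi>. indicator K \<xi> + (norm (g \<xi>))\<^sup>2)"
    using g by (auto simp: square_integrable_def)
  show "g \<in> borel_measurable lborel" using g by (simp add: square_integrable_def)
  have le: "t \<le> 1 + t\<^sup>2" for t :: real
  proof -
    have "2 * t \<le> t\<^sup>2 + 1" using sum_squares_bound[of t 1] by simp
    thus ?thesis using zero_le_power2[of t] by linarith
  qed
  show "AE \<xi> in lborel. norm (g \<xi>) \<le> norm (indicator K \<xi> + (norm (g \<xi>))\<^sup>2)"
    using K(2) by eventually_elim (use le in \<open>auto simp: indicator_def\<close>)
qed

lemma vanishing_on_open_compact_spectrum_imp_zero:
  fixes f g :: "real^'d \<Rightarrow> complex"
  assumes cont: "continuous_on UNIV f" and U: "open U" "U \<noteq> {}" "\<And>x. x \<in> U \<Longrightarrow> f x = 0"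
    and fg: "has_fourier_transform_L2 f g" and supp: "ae_compactly_supported g"
  shows "f x = 0"
proof -
  obtain K where K: "compact K" "AE \<xi> in lborel. \<xi> \<notin> K \<longrightarrow> g \<xi> = 0"
    using supp unfolding ae_compactly_supported_def by blast
  have g2: "square_integrable lborel g" using fg by (simp add: has_fourier_transform_L2_def)
  have g: "integrable lborel g" by (rule L2_compact_support_integrable[OF g2 K])
  have [measurable]: "g \<in> borel_measurable borel" using g by auto
  have [measurable]: "K \<in> sets borel" using K(1) by (simp add: borel_closed compact_imp_closed)
  \<comment> \<open>Zero almost everywhere off \<open>K\<close> becomes zero everywhere off \<open>K\<close>, at no cost to the
    integral.\<close>
  define G where "G = (\<lambda>\<xi>. if \<xi> \<in> K then g \<xi> else 0)"
  have [measurable]: "G \<in> borel_measurable borel" unfolding G_def by measurable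
  have inv: "of_real ((2 * pi) ^ CARD('d)) * f x = (LINT \<xi>|lborel. G \<xi> * iexp (x \<bullet> \<xi>))" for x
  proof -
    have "isCont f x" using cont by (simp add: continuous_on_eq_continuous_at)
    from fourier_inversion_integrable[OF fg this g]
    have "of_real ((2 * pi) ^ CARD('d)) * f x = (LINT \<xi>|lborel. g \<xi> * iexp (x \<bullet> \<xi>))" .
    also have "\<dots> = (LINT \<xi>|lborel. G \<xi> * iexp (x \<bullet> \<xi>))"
      by (intro integral_cong_AE) (use K(2) in \<open>auto simp: G_def elim!: eventually_mono\<close>)
    finally show ?thesis .
  qed
  obtain R where R: "\<And>\<xi>. \<xi> \<in> K \<Longrightarrow> norm \<xi> \<le> R"
    using compact_imp_bounded[OF K(1)] unfolding bounded_iff by blast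
  have "(LINT \<xi>|lborel. G \<xi> * iexp (x \<bullet> \<xi>)) = 0"
  proof (rule fourier_band_limited_zero_on_open[of G R U])
    show "integrable lborel G" by (rule Bochner_Integration.integrable_bound[OF g]) (auto simp: G_def)
    show "G \<xi> = 0" if "norm \<xi> > R" for \<xi> using R[of \<xi>] that by (auto simp: G_def)
    show "(LINT \<xi>|lborel. G \<xi> * iexp (x \<bullet> \<xi>)) = 0" if "x \<in> U" for x
      using inv[of x] U(3)[OF that] by simp
  qed (use U in auto)
  hence "complex_of_real ((2 * pi) ^ CARD('d)) * f x = 0" using inv by simp
  thus ?thesis by simp
qed

section \<open>The two uniqueness statements\<close>

theorem proposition24p1:
  shows "(\<forall>f :: real \<Rightarrow> complex.
            periodic_2pi f \<and> square_integrable circle_measure f \<and> continuous_on UNIV f \<and>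
            infinite {t \<in> {0..<2 * pi}. f t = 0} \<and>
            finite {n :: int. fourier_coeff f n \<noteq> 0}
            \<longrightarrow> (\<forall>t. f t = 0))
       \<and> (\<forall>f :: real^'d \<Rightarrow> complex.
            square_integrable lborel f \<and> continuous_on UNIV f \<and>
            (\<exists>U. open U \<and> U \<noteq> {} \<and> (\<forall>x\<in>U. f x = 0)) \<and>
            (\<exists>g. has_fourier_transform_L2 f g \<and> ae_compactly_supported g)
            \<longrightarrow> (\<forall>x. f x = 0))"
proof (intro conjI allI impI)
  fix f :: "real \<Rightarrow> complex" and t
  assume "periodic_2pi f \<and> square_integrable circle_measure f \<and> continuous_on UNIV f \<and>
    infinite {t \<in> {0..<2 * pi}. f t = 0} \<and> finite {n :: int. fourier_coeff f n \<noteq> 0}"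
  hence per: "periodic_2pi f" and cont: "continuous_on UNIV f"
    and inf: "infinite {t \<in> {0..<2 * pi}. f t = 0}" and fin: "finite {n. fourier_coeff f n \<noteq> 0}"
    by blast+
  note trig = finite_fourier_support_imp_trig_poly[OF per cont fin]
  show "f t = 0"
    using trig_poly_infinite_zeros[OF fin, of "fourier_coeff f" t] inf by (simp flip: trig)
next
  fix f :: "real^'d \<Rightarrow> complex" and x
  assume "square_integrable lborel f \<and> continuous_on UNIV f \<and>
    (\<exists>U. open U \<and> U \<noteq> {} \<and> (\<forall>x\<in>U. f x = 0)) \<and>
    (\<exists>g. has_fourier_transform_L2 f g \<and> ae_compactly_supported g)"
  thus "f x = 0"
    using vanishing_on_open_compact_spectrum_imp_zero by blast
qed

end
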